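(* Assume Baumgartner's axiom, $2^{\aleph_0}=\aleph_1$ and $2^{\aleph_1}=\kappa$. Then $\mathfrak{ap}_{\aleph_1}=\kappa$.
   Context: Forcing convention: $p\leq q$ means that $q$ is stronger than $p$. A subset of a forcing notion is linked if its elements are pairwise compatible; $\mathbb{P}$ is $\aleph_1$-linked if $\mathbb{P}=\bigcup_{\gamma<\omega_1}L_\gamma$ with each $L_\gamma$ linked; $\mathbb{P}$ is well-met if any two compatible conditions have a least upper bound; $\mathbb{P}$ is countably closed if every increasing $\omega$-sequence of conditions has an upper bound. Baumgartner's axiom: for every countably closed, $\aleph_1$-linked, well-met forcing notion $\mathbb{P}$ and every collection $\{D_\alpha:\alpha<\theta\}$ of dense subsets of $\mathbb{P}$ with $\theta<2^{\aleph_1}$, there is a filter (downward closed and directed set) $G\subseteq\mathbb{P}$ with $G\cap D_\alpha\neq\varnothing$ for every $\alpha<\theta$. Let $\mu$ be an infinite regular cardinal. A family $E=\{e_\alpha:\alpha<\lambda\}\subseteq[\mu]^{\mu}$ is almost disjoint iff $|e_\alpha\cap e_\beta|<\mu$ for all $\alpha<\beta<\lambda$. For such $E$ and $A\subseteq\lambda$, a set $x\subseteq\mu$ depicts the pair $(A,E)$ iff for every $\alpha<\lambda$: $|e_\alpha\cap x|=\mu\Leftrightarrow\alpha\in A$. If no $x\subseteq\mu$ depicts $(A,E)$, the pair $(A,E)$ is called indepictable. The cardinal $\mathfrak{ap}_\mu$ is the minimal cardinal $\lambda$ for which there are an almost disjoint family $E=\{e_\alpha:\alpha<\lambda\}\subseteq[\mu]^{\mu}$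 and a subset $A\subseteq\lambda$ such that $(A,E)$ is indepictable. *)

theory Defs
  imports Main
begin

unbundle cardinal_syntax

text \<open>
  Cardinals are represented as in the library's theory of cardinals: a cardinal is a relation
  \<open>r\<close> with \<open>Card_order r\<close>, i.e. an initial well-order, its underlying set is \<open>Field r\<close>, and
  equality and order of cardinals are \<open>=o\<close>, \<open>\<le>o\<close>, \<open><o\<close>.  In particular \<open>Field aleph1\<close> is a
  set of order type \<open>\<omega>\<^sub>1\<close>.
\<close>

abbreviation aleph0 :: "nat rel" where
  "aleph0 \<equiv> natLeq"

abbreviation aleph1 :: "nat set rel" where
  "aleph1 \<equiv> cardSuc aleph0"


section \<open>Forcing notions\<close>

text \<open>
  A pair \<open>(p, q) \<in> le\<close> means that \<open>q\<close> is stronger than \<open>p\<close>.  Antisymmetry is not required, so a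
  \<open>least upper bound\<close> need not be unique.  The carrier has to be nonempty: otherwise
  Baumgartner's axiom would fail for the empty order, whose empty subset is dense.
\<close>

definition forcing_notion :: "'p set \<Rightarrow> 'p rel \<Rightarrow> bool" where
  "forcing_notion P le \<longleftrightarrow> P \<noteq> {} \<and> preorder_on P le"

definition compatible :: "'p set \<Rightarrow> 'p rel \<Rightarrow> 'p \<Rightarrow> 'p \<Rightarrow> bool" where
  "compatible P le p q \<longleftrightarrow> (\<exists>r\<in>P. (p, r) \<in> le \<and> (q, r) \<in> le)"

definition linked :: "'p set \<Rightarrow> 'p rel \<Rightarrow> 'p set \<Rightarrow> bool" where
  "linked P le L \<longleftrightarrow> L \<subseteq> P \<and> (\<forall>p\<in>L. \<forall>q\<in>L. compatible P le p q)"

definition aleph1_linked :: "'p set \<Rightarrow> 'p rel \<Rightarrow> bool" where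
  "aleph1_linked P le \<longleftrightarrow>
     (\<exists>L :: nat set \<Rightarrow> 'p set.
        P = (\<Union>\<gamma>\<in>Field aleph1. L \<gamma>) \<and> (\<forall>\<gamma>\<in>Field aleph1. linked P le (L \<gamma>)))"

definition is_lub :: "'p set \<Rightarrow> 'p rel \<Rightarrow> 'p \<Rightarrow> 'p \<Rightarrow> 'p \<Rightarrow> bool" where
  "is_lub P le p q r \<longleftrightarrow>
     r \<in> P \<and> (p, r) \<in> le \<and> (q, r) \<in> le \<and>
     (\<forall>s\<in>P. (p, s) \<in> le \<and> (q, s) \<in> le \<longrightarrow> (r, s) \<in> le)"

definition well_met :: "'p set \<Rightarrow> 'p rel \<Rightarrow> bool" where
  "well_met P le \<longleftrightarrow>
     (\<forall>p\<in>P. \<forall>q\<in>P. compatible P le p q \<longrightarrow> (\<exists>r. is_lub P le p q r))"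

definition countably_closed :: "'p set \<Rightarrow> 'p rel \<Rightarrow> bool" where
  "countably_closed P le \<longleftrightarrow>
     (\<forall>p :: nat \<Rightarrow> 'p. (\<forall>n. p n \<in> P) \<and> (\<forall>n. (p n, p (Suc n)) \<in> le) \<longrightarrow>
        (\<exists>q\<in>P. \<forall>n. (p n, q) \<in> le))"

definition dense_subset :: "'p set \<Rightarrow> 'p rel \<Rightarrow> 'p set \<Rightarrow> bool" where
  "dense_subset P le D \<longleftrightarrow> D \<subseteq> P \<and> (\<forall>p\<in>P. \<exists>q\<in>D. (p, q) \<in> le)"

definition forcing_filter :: "'p set \<Rightarrow> 'p rel \<Rightarrow> 'p set \<Rightarrow> bool" where
  "forcing_filter P le G \<longleftrightarrow>
     G \<subseteq> P \<and>
     (\<forall>q\<in>G. \<forall>p\<in>P. (p, q) \<in> le \<longrightarrow> p \<in> G) \<and>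
     (\<forall>p\<in>G. \<forall>q\<in>G. \<exists>r\<in>G. (p, r) \<in> le \<and> (q, r) \<in> le)"

text \<open>
  Baumgartner's axiom for the forcing notions whose conditions are elements of the type \<open>'p\<close>.
  HOL cannot quantify over all types inside a formula, but nothing is lost as soon as \<open>'p\<close> has
  at least \<open>2\<close> to the power \<open>\<aleph>\<^sub>1\<close> elements: given an arbitrary \<open>P\<close> and fewer than that many
  dense sets, choose functions yielding least upper bounds of pairs, upper bounds of increasing
  \<open>\<omega>\<close>-sequences and extensions into the dense sets; closing a condition under these functions
  gives a suborder with at most \<open>2\<close> to the power \<open>\<aleph>\<^sub>1\<close> elements which satisfies all hypotheses,
  in which the traces of the dense sets are dense, and whose filters generate filters of \<open>P\<close>.
  The type \<open>nat set set\<close> is large enough in this sense, as \<open>\<aleph>\<^sub>1\<close> is at most the cardinality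
  of \<open>nat set\<close>.
\<close>

definition baumgartner_axiom :: "'p itself \<Rightarrow> bool" where
  "baumgartner_axiom _ \<longleftrightarrow>
     (\<forall>(P :: 'p set) le (\<D> :: 'p set set).
        forcing_notion P le \<and> countably_closed P le \<and> aleph1_linked P le \<and> well_met P le \<and>
        (\<forall>D\<in>\<D>. dense_subset P le D) \<and> |\<D>| <o ctwo ^c aleph1 \<longrightarrow>
        (\<exists>G. forcing_filter P le G \<and> (\<forall>D\<in>\<D>. G \<inter> D \<noteq> {})))"


section \<open>Almost disjoint families and depictability\<close>

text \<open>
  Families are indexed by the elements of \<open>Field \<nu>\<close> for a cardinal \<open>\<nu>\<close>; subsets of \<open>\<mu>\<close> are
  subsets of \<open>Field \<mu>\<close>.
\<close>

definition almost_disjoint_family :: "'a rel \<Rightarrow> 'i rel \<Rightarrow> ('i \<Rightarrow> 'a set) \<Rightarrow> bool" where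
  "almost_disjoint_family \<mu> \<nu> e \<longleftrightarrow>
     (\<forall>\<alpha>\<in>Field \<nu>. e \<alpha> \<subseteq> Field \<mu> \<and> |e \<alpha>| =o \<mu>) \<and>
     (\<forall>\<alpha>\<in>Field \<nu>. \<forall>\<beta>\<in>Field \<nu>. \<alpha> \<noteq> \<beta> \<longrightarrow> |e \<alpha> \<inter> e \<beta>| <o \<mu>)"

definition depicts :: "'a rel \<Rightarrow> 'i rel \<Rightarrow> 'a set \<Rightarrow> 'i set \<Rightarrow> ('i \<Rightarrow> 'a set) \<Rightarrow> bool" where
  "depicts \<mu> \<nu> x A e \<longleftrightarrow> (\<forall>\<alpha>\<in>Field \<nu>. |e \<alpha> \<inter> x| =o \<mu> \<longleftrightarrow> \<alpha> \<in> A)"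

definition indepictable :: "'a rel \<Rightarrow> 'i rel \<Rightarrow> 'i set \<Rightarrow> ('i \<Rightarrow> 'a set) \<Rightarrow> bool" where
  "indepictable \<mu> \<nu> A e \<longleftrightarrow> \<not> (\<exists>x. x \<subseteq> Field \<mu> \<and> depicts \<mu> \<nu> x A e)"

definition has_indepictable_pair :: "'a rel \<Rightarrow> 'i rel \<Rightarrow> bool" where
  "has_indepictable_pair \<mu> \<nu> \<longleftrightarrow>
     (\<exists>e A. almost_disjoint_family \<mu> \<nu> e \<and> A \<subseteq> Field \<nu> \<and> indepictable \<mu> \<nu> A e)"

text \<open>
  The cardinal \<open>ap \<mu>\<close> is meant for infinite regular \<open>\<mu>\<close>.  An almost disjoint family on \<open>\<mu>\<close>
  is injective, so only cardinals up to the cardinality of the power set of \<open>\<mu>\<close> can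
  carry one, and all of these are represented by relations on \<open>'a set\<close>.  As with \<open>cardSuc\<close>,
  the representative is determined up to \<open>=o\<close>.
\<close>

definition ap :: "'a rel \<Rightarrow> 'a set rel" where
  "ap \<mu> = (SOME \<nu>. Card_order \<nu> \<and> has_indepictable_pair \<mu> \<nu> \<and>
     (\<forall>\<nu>' :: 'a set rel. Card_order \<nu>' \<and> has_indepictable_pair \<mu> \<nu>' \<longrightarrow> \<nu> \<le>o \<nu>'))"

end

theory Submission
  imports Defs "HOL-Library.Countable_Set_Type"
begin

text \<open>
  Lower bound: for fewer than \<open>2\<close> to the power \<open>\<aleph>\<^sub>1\<close> sets \<open>e \<alpha>\<close>, force with countable approximations
  \<open>s\<close> of a depicting set together with countably many \<open>\<alpha> \<notin> A\<close> for which \<open>e \<alpha>\<close> must not be met outside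
  \<open>s\<close>.  Conditions with the same \<open>s\<close> are compatible and CH leaves only \<open>\<aleph>\<^sub>1\<close> many \<open>s\<close>, so
  Baumgartner's axiom applies.  For \<open>\<alpha> \<in> A\<close> almost disjointness makes it dense to add elements of
  \<open>e \<alpha>\<close> above any given countable ordinal.

  Upper bound: under CH the branches of the tree of binary sequences of countable length give
  an almost disjoint family of size \<open>2\<close> to the power \<open>\<aleph>\<^sub>1\<close>, and it has more subfamilies than there
  are subsets \<open>x\<close> of \<open>\<omega>\<^sub>1\<close>, each of which depicts at most one of them.
\<close>

section \<open>Countability and cardinal arithmetic around \<open>aleph1\<close>\<close>

lemma Card_order_aleph1: "Card_order aleph1"
  by (simp add: cardSuc_Card_order natLeq_Card_order)

lemma countable_iff_ordLess_aleph1: "countable S \<longleftrightarrow> |S| <o aleph1"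
  by (simp add: cardSuc_ordLeq_ordLess[OF natLeq_Card_order card_of_Card_order] countable_card_le_natLeq)

text \<open>A subset of \<open>Field aleph1\<close> has at most \<open>aleph1\<close> elements, so
  being uncountable leaves only full size. Cardinality conditions on such sets thus become
  countability conditions.\<close>

lemma uncountable_iff_ordIso_aleph1:
  assumes "S \<subseteq> Field aleph1"
  shows "uncountable S \<longleftrightarrow> |S| =o aleph1"
proof -
  have "|S| \<le>o aleph1"
    using card_of_mono1[OF assms] card_of_Field_ordIso[OF Card_order_aleph1] ordLeq_ordIso_trans by blast
  then show ?thesis
    unfolding countable_iff_ordLess_aleph1
    by (meson not_ordLess_ordIso ordLeq_iff_ordLess_or_ordIso)
qed

lemma uncountable_Field_aleph1: "uncountable (Field aleph1)"
  using uncountable_iff_ordIso_aleph1[of "Field aleph1"] card_of_Field_ordIso[OF Card_order_aleph1]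
  by simp

lemma countable_underS_aleph1: "countable (underS aleph1 \<xi>)"
proof (cases "\<xi> \<in> Field aleph1")
  case True
  then show ?thesis
    unfolding countable_iff_ordLess_aleph1
    using card_of_underS[OF Card_order_aleph1] by blast
next
  case False
  then have "underS aleph1 \<xi> = {}"
    by (auto simp: underS_def Field_def)
  then show ?thesis by simp
qed

lemma not_in_underS_aleph1:
  assumes "\<xi> \<in> Field aleph1" "\<alpha> \<in> Field aleph1" "\<xi> \<notin> underS aleph1 \<alpha>"
  shows "\<alpha> \<in> insert \<xi> (underS aleph1 \<xi>)"
proof -
  have "Total aleph1"
    using Card_order_aleph1
    by (simp add: card_order_on_def well_order_on_def linear_order_on_def)
  then show ?thesis
    using assms by (auto simp: underS_def total_on_def)
qed

text \<open>The product is either finite or bounded by the disjoint sum, which stays below an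
  infinite \<open>|C|\<close>. It serves to count the dense sets.\<close>

lemma card_of_Times_ordLess_infinite:
  assumes inf: "infinite C" and "|A| <o |C|" "|B| <o |C|"
  shows "|A \<times> B| <o |C|"
proof (cases "finite (A <+> B)")
  case True
  then have "finite (A \<times> B)" by (simp add: finite_Plus_iff)
  then show ?thesis
    using inf by (meson card_of_ordLeq_infinite not_ordLeq_iff_ordLess card_of_Well_order)
next
  case False
  then have "|A \<times> B| \<le>o |A <+> B|"
    using card_of_Times_ordLeq_infinite_Field[of "|A <+> B|" A B]
    by (simp add: Field_card_of card_of_card_order_on card_of_Plus1 card_of_Plus2)
  then show ?thesis
    using card_of_Plus_ordLess_infinite assms ordLeq_ordLess_trans by blast
qed

text \<open>A nonempty countable \<open>F\<close> is the range of a sequence, and the codes of its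
  terms are stored as the sections of a single subset of \<open>UNIV \<times> B\<close>. There are
  only \<open>|Pow B|\<close> such subsets, since \<open>B\<close> is infinite.\<close>

lemma card_of_countable_subsets:
  assumes "|A| \<le>o |Pow B|" and inf: "infinite B"
  shows "|{F. F \<subseteq> A \<and> countable F}| \<le>o |Pow B|"
proof -
  obtain f where f: "inj_on f A" "f ` A \<subseteq> Pow B"
    using assms(1) card_of_ordLeq[of A "Pow B"] by blast
  define dec where "dec E = {a \<in> A. \<exists>n. f a = E `` {n}}" for E :: "(nat \<times> 'b) set"
  \<comment> \<open>The empty set is set apart because no sequence enumerates it.\<close>
  have "F \<in> insert {} (dec ` Pow (UNIV \<times> B))" if F: "F \<subseteq> A" "countable F" for F
  proof (cases "F = {}")
    case False
    define E where "E = {(n, b). b \<in> f (from_nat_into F n)}"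
    have E: "E `` {n} = f (from_nat_into F n)" for n
      by (auto simp: E_def)
    have F': "from_nat_into F n \<in> F" for n
      using False by (rule from_nat_into)
    have "a \<in> F" if "a \<in> A" "f a = E `` {n}" for a n
      using that F' F(1) inj_onD[OF f(1)] unfolding E by (metis subsetD)
    moreover have "\<exists>n. f a = E `` {n}" if "a \<in> F" for a
      using that F(2) unfolding E by (metis from_nat_into_to_nat_on)
    ultimately have "F = dec E"
      using F(1) by (auto simp: dec_def)
    moreover have "E \<in> Pow (UNIV \<times> B)"
      using F' F(1) f(2) by (auto simp: E_def)
    ultimately show ?thesis by blast
  qed simp
  then have sub: "{F. F \<subseteq> A \<and> countable F} \<subseteq> {{}} \<union> dec ` Pow (UNIV \<times> B)"
    by auto
  have "|UNIV :: nat set| \<le>o |B|"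
    using inf infinite_iff_card_of_nat by blast
  then have "|(UNIV :: nat set) \<times> B| \<le>o |B|"
    using card_of_Times_ordLeq_infinite_Field[of "|B|" "UNIV :: nat set" B] inf
    by (simp add: card_of_mono1 Field_card_of card_of_card_order_on)
  then have "|Pow ((UNIV :: nat set) \<times> B)| \<le>o |Pow B|"
    unfolding card_of_ordLeq[symmetric] by (meson image_Pow_mono inj_on_image_Pow)
  then have "|dec ` Pow (UNIV \<times> B)| \<le>o |Pow B|"
    using card_of_image ordLeq_transitive by blast
  moreover have "|{{}} :: 'a set set| \<le>o |Pow B|"
    by (rule card_of_singl_ordLeq) auto
  ultimately have "|{{}} \<union> dec ` Pow (UNIV \<times> B)| \<le>o |Pow B|"
    using card_of_Un_ordLeq_infinite_Field[of "|Pow B|" "{{}}" "dec ` Pow (UNIV \<times> B)"] inf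
    by (simp add: Field_card_of card_of_card_order_on)
  then show ?thesis
    using card_of_mono1[OF sub] ordLeq_transitive by blast
qed

lemma ctwo_cexp_ordIso_Pow:
  assumes "Card_order r"
  shows "ctwo ^c r =o |Pow (Field r)|"
proof -
  have "|Pow (Field r)| =o ctwo ^c |Field r|"
    using card_of_Pow_Func by (auto simp: cexp_def ctwo_def Field_card_of)
  moreover have "ctwo ^c |Field r| =o ctwo ^c r"
    using cexp_cong2[OF card_of_Field_ordIso[OF assms] Card_order_ctwo card_of_Card_order] assms
    by auto
  ultimately show ?thesis
    using ordIso_symmetric ordIso_transitive by blast
qed

section \<open>Transfer of Baumgartner's axiom along injections\<close>

text \<open>The axiom concerns one fixed type of conditions. An order on another type is copied
  along \<open>h\<close>, all hypotheses carry over to the copy, and the filter found there is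
  pulled back. This makes pairs available as conditions.\<close>

lemma baumgartner_axiom_inj_on:
  fixes P :: "'q set" and h :: "'q \<Rightarrow> 'p"
  assumes BA: "baumgartner_axiom TYPE('p)" and inj: "inj_on h P"
    and fn: "forcing_notion P le" and cc: "countably_closed P le"
    and lk: "aleph1_linked P le" and wm: "well_met P le"
    and dn: "\<And>D. D \<in> \<D> \<Longrightarrow> dense_subset P le D" and card: "|\<D>| <o ctwo ^c aleph1"
  obtains G where "forcing_filter P le G" "\<And>D. D \<in> \<D> \<Longrightarrow> G \<inter> D \<noteq> {}"
proof -
  define le' where "le' = {(h p, h q) |p q. p \<in> P \<and> q \<in> P \<and> (p, q) \<in> le}"
  have le'[simp]: "(h p, h q) \<in> le' \<longleftrightarrow> (p, q) \<in> le" if "p \<in> P" "q \<in> P" for p q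
    using that inj by (auto simp: le'_def dest: inj_onD)
  have comp: "compatible (h ` P) le' (h p) (h q) \<longleftrightarrow> compatible P le p q"
    if "p \<in> P" "q \<in> P" for p q
    using that by (auto simp: compatible_def)
  have "forcing_notion (h ` P) le'"
  proof -
    have "trans le'"
      using fn inj unfolding forcing_notion_def preorder_on_def le'_def trans_def
      by (smt (verit) inj_onD mem_Collect_eq prod.inject)
    then show ?thesis
      using fn by (auto simp: forcing_notion_def preorder_on_def refl_on_def) (auto simp: le'_def)
  qed
  moreover have "countably_closed (h ` P) le'"
    unfolding countably_closed_def
  proof (intro allI impI, elim conjE)
    fix p :: "nat \<Rightarrow> 'p"
    assume p: "\<forall>n. p n \<in> h ` P" and inc: "\<forall>n. (p n, p (Suc n)) \<in> le'"
    from p have "\<forall>n. \<exists>q. q \<in> P \<and> p n = h q" by blast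
    then obtain q where q: "\<And>n. q n \<in> P" "\<And>n. p n = h (q n)" by metis
    then have "\<forall>n. (q n, q (Suc n)) \<in> le" using inc by simp
    then obtain r where "r \<in> P" "\<forall>n. (q n, r) \<in> le"
      using cc q(1) unfolding countably_closed_def by blast
    then show "\<exists>q\<in>h ` P. \<forall>n. (p n, q) \<in> le'"
      using q by auto
  qed
  moreover have "aleph1_linked (h ` P) le'"
  proof -
    from lk obtain L :: "nat set \<Rightarrow> 'q set" where L: "P = (\<Union>\<gamma>\<in>Field aleph1. L \<gamma>)"
      "\<And>\<gamma>. \<gamma> \<in> Field aleph1 \<Longrightarrow> linked P le (L \<gamma>)"
      unfolding aleph1_linked_def by blast
    have "linked (h ` P) le' (h ` L \<gamma>)" if "\<gamma> \<in> Field aleph1" for \<gamma>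
      using L(2)[OF that] by (auto simp: linked_def comp subset_iff)
    moreover have "h ` P = (\<Union>\<gamma>\<in>Field aleph1. h ` L \<gamma>)"
      by (subst L(1)) blast
    ultimately show ?thesis
      unfolding aleph1_linked_def by (intro exI[of _ "\<lambda>\<gamma>. h ` L \<gamma>"]) simp
  qed
  moreover have "well_met (h ` P) le'"
    unfolding well_met_def
  proof (intro ballI impI)
    fix p' q' assume "p' \<in> h ` P" "q' \<in> h ` P" and c: "compatible (h ` P) le' p' q'"
    then obtain p q where pq: "p \<in> P" "q \<in> P" "p' = h p" "q' = h q" by blast
    then obtain r where "is_lub P le p q r"
      using wm c comp unfolding well_met_def by metis
    then have "is_lub (h ` P) le' p' q' (h r)"
      using pq by (auto simp: is_lub_def)
    then show "\<exists>r. is_lub (h ` P) le' p' q' r" ..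
  qed
  moreover have "\<forall>D\<in>(`) h ` \<D>. dense_subset (h ` P) le' D"
  proof
    fix D' assume "D' \<in> (`) h ` \<D>"
    then obtain D where D: "D \<in> \<D>" "D' = h ` D" by blast
    then have "D \<subseteq> P" "\<And>p. p \<in> P \<Longrightarrow> \<exists>q\<in>D. (p, q) \<in> le"
      using dn unfolding dense_subset_def by blast+
    then show "dense_subset (h ` P) le' D'"
      unfolding dense_subset_def D(2) by (auto simp: subset_iff)
  qed
  moreover have "|(`) h ` \<D>| <o ctwo ^c aleph1"
    using card_of_image card ordLeq_ordLess_trans by blast
  ultimately have "\<exists>G'. forcing_filter (h ` P) le' G' \<and> (\<forall>D\<in>(`) h ` \<D>. G' \<inter> D \<noteq> {})"
    by (intro BA[unfolded baumgartner_axiom_def, rule_format] conjI) simp_all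
  then obtain G' where G': "forcing_filter (h ` P) le' G'" "\<forall>D\<in>(`) h ` \<D>. G' \<inter> D \<noteq> {}"
    by blast
  define G where "G = {p \<in> P. h p \<in> G'}"
  show ?thesis
  proof
    show "forcing_filter P le G"
      unfolding forcing_filter_def
    proof (intro conjI ballI impI)
      show "G \<subseteq> P" by (auto simp: G_def)
    next
      fix q p assume "q \<in> G" "p \<in> P" "(p, q) \<in> le"
      then have "h q \<in> G'" "h p \<in> h ` P" "(h p, h q) \<in> le'"
        by (auto simp: G_def)
      then have "h p \<in> G'"
        using G'(1) unfolding forcing_filter_def by blast
      then show "p \<in> G" using \<open>p \<in> P\<close> by (simp add: G_def)
    next
      fix p q assume pq: "p \<in> G" "q \<in> G"
      then obtain r' where r': "r' \<in> G'" "(h p, r') \<in> le'" "(h q, r') \<in> le'"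
        using G'(1) unfolding forcing_filter_def G_def by blast
      then obtain r where "r \<in> P" "r' = h r"
        using G'(1) unfolding forcing_filter_def by blast
      then show "\<exists>r\<in>G. (p, r) \<in> le \<and> (q, r) \<in> le"
        using r' pq by (auto simp: G_def)
    qed
  next
    fix D assume D: "D \<in> \<D>"
    then have "G' \<inter> h ` D \<noteq> {}" using G'(2) by blast
    moreover have "D \<subseteq> P" using dn[OF D] by (simp add: dense_subset_def)
    ultimately show "G \<inter> D \<noteq> {}" by (auto simp: G_def)
  qed
qed

section \<open>Countable and uncountable subsets of \<open>\<omega>\<^sub>1\<close>\<close>

text \<open>CH identifies \<open>|Field aleph1|\<close> with the continuum, and a set of continuum
  size has only continuum many countable subsets.\<close>

lemma card_of_countable_subsets_aleph1:
  assumes "ctwo ^c aleph0 =o aleph1"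
  shows "|{s. s \<subseteq> Field aleph1 \<and> countable s}| \<le>o |Field aleph1|"
proof -
  have "|Pow (UNIV :: nat set)| =o aleph1"
    using ctwo_cexp_ordIso_Pow[OF natLeq_Card_order] assms
    by (metis Field_natLeq ordIso_symmetric ordIso_transitive)
  then have *: "|Field aleph1| =o |Pow (UNIV :: nat set)|"
    using card_of_Field_ordIso[OF Card_order_aleph1] ordIso_symmetric ordIso_transitive by blast
  have "|{s. s \<subseteq> Field aleph1 \<and> countable s}| \<le>o |Pow (UNIV :: nat set)|"
    using card_of_countable_subsets[OF ordIso_imp_ordLeq[OF *] infinite_UNIV_nat] .
  then show ?thesis
    using * ordIso_symmetric ordLeq_ordIso_trans by blast
qed

lemma infinite_Field_aleph1: "infinite (Field aleph1)"
  using uncountable_Field_aleph1 uncountable_infinite by blast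

lemma almost_disjoint_familyD_aleph1:
  assumes "almost_disjoint_family aleph1 \<nu> e" "\<alpha> \<in> Field \<nu>"
  shows "e \<alpha> \<subseteq> Field aleph1" "uncountable (e \<alpha>)"
    and "\<And>\<beta>. \<beta> \<in> Field \<nu> \<Longrightarrow> \<alpha> \<noteq> \<beta> \<Longrightarrow> countable (e \<alpha> \<inter> e \<beta>)"
  using assms uncountable_iff_ordIso_aleph1[of "e \<alpha>"]
  unfolding almost_disjoint_family_def countable_iff_ordLess_aleph1 by auto

lemma depicts_aleph1_iff:
  assumes "x \<subseteq> Field aleph1"
  shows "depicts aleph1 \<nu> x A e \<longleftrightarrow> (\<forall>\<alpha>\<in>Field \<nu>. uncountable (e \<alpha> \<inter> x) \<longleftrightarrow> \<alpha> \<in> A)"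
proof -
  have "uncountable (e \<alpha> \<inter> x) \<longleftrightarrow> |e \<alpha> \<inter> x| =o aleph1" for \<alpha>
    using assms by (intro uncountable_iff_ordIso_aleph1) auto
  then show ?thesis by (simp add: depicts_def)
qed

text \<open>Regularity of \<open>\<omega>\<^sub>1\<close>: the closed initial segments given by the
  elements of an unbounded \<open>x\<close> cover \<open>\<omega>\<^sub>1\<close>, and countably
  many of them have a countable union.\<close>

lemma uncountable_if_unbounded_aleph1:
  assumes "x \<subseteq> Field aleph1" "\<And>\<xi>. \<xi> \<in> Field aleph1 \<Longrightarrow> \<exists>y\<in>x. y \<notin> underS aleph1 \<xi>"
  shows "uncountable x"
proof
  assume "countable x"
  then have "countable (\<Union>y\<in>x. insert y (underS aleph1 y))"
    by (intro countable_UN) (auto simp: countable_underS_aleph1)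
  moreover have "Field aleph1 \<subseteq> (\<Union>y\<in>x. insert y (underS aleph1 y))"
  proof
    fix \<xi> assume \<xi>: "\<xi> \<in> Field aleph1"
    then obtain y where "y \<in> x" "y \<notin> underS aleph1 \<xi>"
      using assms(2) by blast
    then show "\<xi> \<in> (\<Union>y\<in>x. insert y (underS aleph1 y))"
      using assms(1) not_in_underS_aleph1[of y \<xi>] \<xi> by blast
  qed
  ultimately show False
    using uncountable_Field_aleph1 countable_subset by blast
qed

section \<open>The forcing notion of depicting conditions\<close>

text \<open>
  A condition \<open>(s, F)\<close> is a countable approximation \<open>s\<close> of the depicting set together with the
  promise to add no further elements of \<open>e \<alpha>\<close> for the countably many \<open>\<alpha> \<in> F\<close>.
\<close>

definition depicting_conditions :: "'i set \<Rightarrow> (nat set set \<times> 'i set) set" where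
  "depicting_conditions B =
     {s. s \<subseteq> Field aleph1 \<and> countable s} \<times> {F. F \<subseteq> B \<and> countable F}"

definition depicting_order :: "'i set \<Rightarrow> ('i \<Rightarrow> nat set set) \<Rightarrow> (nat set set \<times> 'i set) rel" where
  "depicting_order B e =
     {((s, F), (t, G)). (s, F) \<in> depicting_conditions B \<and> (t, G) \<in> depicting_conditions B \<and>
        s \<subseteq> t \<and> F \<subseteq> G \<and> (\<forall>\<alpha>\<in>F. (t - s) \<inter> e \<alpha> = {})}"

lemma mem_depicting_conditions:
  "(s, F) \<in> depicting_conditions B \<longleftrightarrow>
     s \<subseteq> Field aleph1 \<and> countable s \<and> F \<subseteq> B \<and> countable F"
  by (auto simp: depicting_conditions_def)

lemma mem_depicting_order:
  "((s, F), (t, G)) \<in> depicting_order B e \<longleftrightarrow>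
     (s, F) \<in> depicting_conditions B \<and> (t, G) \<in> depicting_conditions B \<and>
     s \<subseteq> t \<and> F \<subseteq> G \<and> (\<forall>\<alpha>\<in>F. (t - s) \<inter> e \<alpha> = {})"
  by (simp add: depicting_order_def)

lemma trans_depicting_order: "trans (depicting_order B e)"
  unfolding trans_def by (clarsimp simp: mem_depicting_order) blast

lemma forcing_notion_depicting: "forcing_notion (depicting_conditions B) (depicting_order B e)"
proof -
  have "({}, {}) \<in> depicting_conditions B"
    by (simp add: mem_depicting_conditions)
  moreover have "refl_on (depicting_conditions B) (depicting_order B e)"
    by (auto simp: refl_on_def mem_depicting_order)
  moreover have "depicting_order B e \<subseteq> depicting_conditions B \<times> depicting_conditions B"
    by (auto simp: mem_depicting_order)
  ultimately show ?thesis
    using trans_depicting_order by (auto simp: forcing_notion_def preorder_on_def)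
qed

lemma countably_closed_depicting:
  "countably_closed (depicting_conditions B) (depicting_order B e)"
  unfolding countably_closed_def
proof (intro allI impI, elim conjE)
  fix p :: "nat \<Rightarrow> nat set set \<times> 'a set"
  assume P: "\<forall>n. p n \<in> depicting_conditions B"
    and inc: "\<forall>n. (p n, p (Suc n)) \<in> depicting_order B e"
  define s where "s n = fst (p n)" for n
  define F where "F n = snd (p n)" for n
  have p: "p n = (s n, F n)" for n by (simp add: s_def F_def)
  have le: "(p n, p m) \<in> depicting_order B e" if "n \<le> m" for n m
    using that
  proof (induction m rule: dec_induct)
    case base
    then show ?case using P by (simp add: p mem_depicting_order)
  next
    case (step m)
    then show ?case using inc trans_depicting_order by (meson transE)
  qed
  have Q: "(\<Union>n. s n, \<Union>n. F n) \<in> depicting_conditions B"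
    using P unfolding p mem_depicting_conditions by (auto intro!: countable_UN)
  have "(p n, (\<Union>n. s n, \<Union>n. F n)) \<in> depicting_order B e" for n
  proof -
    \<comment> \<open>For \<open>n \<le> m\<close> this is the promise made at stage
      \<open>n\<close>; otherwise \<open>s m\<close> is contained in \<open>s n\<close>.\<close>
    have "(s m - s n) \<inter> e \<alpha> = {}" if "\<alpha> \<in> F n" for m \<alpha>
      using le[of n m] le[of m n] that unfolding p mem_depicting_order
      by (cases "n \<le> m") auto
    then show ?thesis
      using P Q unfolding p mem_depicting_order by blast
  qed
  then show "\<exists>q\<in>depicting_conditions B. \<forall>n. (p n, q) \<in> depicting_order B e"
    using Q by blast
qed

text \<open>A common extension \<open>(r, H)\<close> contains \<open>t\<close> and adds nothing
  forbidden by \<open>F\<close> to \<open>s\<close>, so \<open>t - s\<close> respects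
  \<open>F\<close>; symmetrically \<open>s - t\<close> respects \<open>G\<close>. Hence the
  coordinatewise union is already an extension of both.\<close>

lemma is_lub_depicting:
  assumes "compatible (depicting_conditions B) (depicting_order B e) (s, F) (t, G)"
  shows "is_lub (depicting_conditions B) (depicting_order B e) (s, F) (t, G) (s \<union> t, F \<union> G)"
proof -
  obtain r H where rH: "((s, F), (r, H)) \<in> depicting_order B e" "((t, G), (r, H)) \<in> depicting_order B e"
    using assms unfolding compatible_def by (metis surj_pair)
  have "(s \<union> t, F \<union> G) \<in> depicting_conditions B"
    using rH by (auto simp: mem_depicting_order mem_depicting_conditions)
  with rH show ?thesis
    by (simp add: is_lub_def mem_depicting_order split_paired_all Ball_def) blast
qed

lemma well_met_depicting: "well_met (depicting_conditions B) (depicting_order B e)"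
  unfolding well_met_def
proof (intro ballI impI)
  fix p q
  assume "compatible (depicting_conditions B) (depicting_order B e) p q"
  then show "\<exists>r. is_lub (depicting_conditions B) (depicting_order B e) p q r"
    using is_lub_depicting by (cases p, cases q) blast
qed

lemma aleph1_linked_depicting:
  assumes "ctwo ^c aleph0 =o aleph1"
  shows "aleph1_linked (depicting_conditions B) (depicting_order B e)"
proof -
  obtain k where k: "inj_on k {s. s \<subseteq> Field aleph1 \<and> countable s}"
    "k ` {s. s \<subseteq> Field aleph1 \<and> countable s} \<subseteq> Field aleph1"
    using card_of_countable_subsets_aleph1[OF assms] unfolding card_of_ordLeq[symmetric] by blast
  \<comment> \<open>Conditions are sorted by the code of their first coordinate; within one class,
    uniting the second coordinates gives a common extension.\<close>
  define L where "L \<gamma> = {p \<in> depicting_conditions B. k (fst p) = \<gamma>}" for \<gamma>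
  have "depicting_conditions B = (\<Union>\<gamma>\<in>Field aleph1. L \<gamma>)"
    using k(2) by (fastforce simp: L_def depicting_conditions_def)
  moreover have "linked (depicting_conditions B) (depicting_order B e) (L \<gamma>)" for \<gamma>
    unfolding linked_def
  proof (intro conjI ballI)
    fix p q assume "p \<in> L \<gamma>" "q \<in> L \<gamma>"
    then obtain s F t G where p: "p = (s, F)" "(s, F) \<in> depicting_conditions B"
      and q: "q = (t, G)" "(t, G) \<in> depicting_conditions B" and "k s = k t"
      by (cases p, cases q) (auto simp: L_def)
    then have [simp]: "t = s"
      using inj_onD[OF k(1)] by (auto simp: mem_depicting_conditions)
    have "(s, F \<union> G) \<in> depicting_conditions B"
      using p q by (auto simp: mem_depicting_conditions)
    then show "compatible (depicting_conditions B) (depicting_order B e) p q"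
      using p q unfolding compatible_def
      by (intro bexI[of _ "(s, F \<union> G)"]) (auto simp: mem_depicting_order)
  qed (auto simp: L_def)
  ultimately show ?thesis
    unfolding aleph1_linked_def by blast
qed

section \<open>Lower bound: small families are depictable\<close>

text \<open>This bound provides the injection of the conditions into the type for which the axiom is
  assumed.\<close>

lemma card_of_depicting_conditions:
  assumes CH: "ctwo ^c aleph0 =o aleph1" and B: "|B| \<le>o |Pow (Field aleph1)|"
  shows "|depicting_conditions B| \<le>o |Pow (Field aleph1)|"
  unfolding depicting_conditions_def
proof (rule card_of_Times_ordLeq_infinite_Field)
  show "|{F. F \<subseteq> B \<and> countable F}| \<le>o |Pow (Field aleph1)|"
    using card_of_countable_subsets[OF B infinite_Field_aleph1] .
  show "|{s. s \<subseteq> Field aleph1 \<and> countable s}| \<le>o |Pow (Field aleph1)|"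
    by (rule card_of_mono1) auto
qed (simp_all add: Field_card_of card_of_card_order_on infinite_Field_aleph1)

proposition depictable_if_baumgartner_axiom:
  fixes \<nu> :: "'i rel"
  assumes BA: "baumgartner_axiom TYPE('p)" and large: "|Pow (Field aleph1)| \<le>o |UNIV :: 'p set|"
    and CH: "ctwo ^c aleph0 =o aleph1"
    and \<nu>: "Card_order \<nu>" "\<nu> <o ctwo ^c aleph1"
    and ad: "almost_disjoint_family aleph1 \<nu> e"
  shows "\<not> indepictable aleph1 \<nu> A e"
proof -
  define B where "B = Field \<nu> - A"
  let ?P = "depicting_conditions B" and ?le = "depicting_order B e"
  have pow: "ctwo ^c aleph1 =o |Pow (Field aleph1)|"
    by (rule ctwo_cexp_ordIso_Pow[OF Card_order_aleph1])
  have card_\<nu>: "|Field \<nu>| <o |Pow (Field aleph1)|"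
    using card_of_Field_ordIso[OF \<nu>(1)] \<nu>(2) pow ordIso_ordLess_trans ordLess_ordIso_trans by blast
  have "|B| \<le>o |Field \<nu>|"
    by (rule card_of_mono1) (auto simp: B_def)
  then have "|B| \<le>o |Pow (Field aleph1)|"
    using card_\<nu> ordLeq_ordLess_trans ordLess_imp_ordLeq by blast
  then have "|?P| \<le>o |UNIV :: 'p set|"
    using card_of_depicting_conditions[OF CH] large ordLeq_transitive by blast
  then obtain h :: "_ \<Rightarrow> 'p" where h: "inj_on h ?P"
    unfolding card_of_ordLeq[symmetric] by blast
  \<comment> \<open>For \<open>\<alpha> \<in> A\<close> the generic set must reach
    \<open>e \<alpha>\<close> at or above \<xi>; for other \<alpha> the promise about
    \<open>e \<alpha>\<close> must be made, whatever \<xi> is. The common index set keeps the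
    counting uniform.\<close>
  define D where "D = (\<lambda>(\<alpha>, \<xi>).
    if \<alpha> \<in> A then {(s, F) \<in> ?P. \<exists>y\<in>s \<inter> e \<alpha>. y \<notin> underS aleph1 \<xi>} else {(s, F) \<in> ?P. \<alpha> \<in> F})"
  have dense: "dense_subset ?P ?le (D (\<alpha>, \<xi>))" if \<alpha>: "\<alpha> \<in> Field \<nu>" for \<alpha> \<xi>
  proof -
    have "\<exists>q\<in>D (\<alpha>, \<xi>). ((s, F), q) \<in> ?le" if p: "(s, F) \<in> ?P" for s F
    proof (cases "\<alpha> \<in> A")
      case True
      have F: "F \<subseteq> Field \<nu>" "\<alpha> \<notin> F" "countable F"
        using p True by (auto simp: mem_depicting_conditions B_def)
      \<comment> \<open>The forbidden part of \<open>e \<alpha>\<close> is countable by almost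
        disjointness, so the uncountable \<open>e \<alpha>\<close> has a point \<open>y\<close> that
        can be added without breaking a promise of \<open>F\<close>.\<close>
      then have "countable (underS aleph1 \<xi> \<union> (\<Union>\<beta>\<in>F. e \<alpha> \<inter> e \<beta>))"
        using almost_disjoint_familyD_aleph1(3)[OF ad \<alpha>] countable_underS_aleph1
        by (intro countable_Un countable_UN) (auto simp: subset_iff)
      then have "\<not> e \<alpha> \<subseteq> underS aleph1 \<xi> \<union> (\<Union>\<beta>\<in>F. e \<alpha> \<inter> e \<beta>)"
        using almost_disjoint_familyD_aleph1(2)[OF ad \<alpha>] countable_subset by blast
      then obtain y where y: "y \<in> e \<alpha>" "y \<notin> underS aleph1 \<xi>" "\<And>\<beta>. \<beta> \<in> F \<Longrightarrow> y \<notin> e \<beta>"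
        by blast
      have "(insert y s, F) \<in> ?P"
        using p y(1) almost_disjoint_familyD_aleph1(1)[OF ad \<alpha>]
        by (auto simp: mem_depicting_conditions)
      then show ?thesis
        using True y p by (intro bexI[of _ "(insert y s, F)"]) (auto simp: D_def mem_depicting_order)
    next
      case False
      then have "(s, insert \<alpha> F) \<in> ?P"
        using p \<alpha> by (auto simp: mem_depicting_conditions B_def)
      then show ?thesis
        using False p by (intro bexI[of _ "(s, insert \<alpha> F)"]) (auto simp: D_def mem_depicting_order)
    qed
    then show ?thesis
      unfolding dense_subset_def by (auto simp: D_def)
  qed
  have "|Field \<nu> \<times> Field aleph1| <o |Pow (Field aleph1)|"
    using card_of_Times_ordLess_infinite[OF _ card_\<nu> card_of_Pow] infinite_Field_aleph1 by simp
  then have "|D ` (Field \<nu> \<times> Field aleph1)| <o ctwo ^c aleph1"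
    using card_of_image ordLeq_ordLess_trans ordLess_ordIso_trans[OF _ ordIso_symmetric[OF pow]] by blast
  moreover have "dense_subset ?P ?le E" if "E \<in> D ` (Field \<nu> \<times> Field aleph1)" for E
    using that dense by auto
  ultimately obtain G where G: "forcing_filter ?P ?le G"
    "\<And>E. E \<in> D ` (Field \<nu> \<times> Field aleph1) \<Longrightarrow> G \<inter> E \<noteq> {}"
    using baumgartner_axiom_inj_on[OF BA h forcing_notion_depicting countably_closed_depicting
        aleph1_linked_depicting[OF CH] well_met_depicting] by metis
  have GP: "G \<subseteq> ?P" using G(1) by (simp add: forcing_filter_def)
  define x where "x = (\<Union>(s, F)\<in>G. s)"
  have x: "x \<subseteq> Field aleph1"
    using GP by (fastforce simp: x_def mem_depicting_conditions)
  have "uncountable (e \<alpha> \<inter> x) \<longleftrightarrow> \<alpha> \<in> A" if \<alpha>: "\<alpha> \<in> Field \<nu>" for \<alpha>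
  proof (cases "\<alpha> \<in> A")
    case True
    have "\<exists>y\<in>e \<alpha> \<inter> x. y \<notin> underS aleph1 \<xi>" if "\<xi> \<in> Field aleph1" for \<xi>
      using G(2)[of "D (\<alpha>, \<xi>)"] that \<alpha> True by (fastforce simp: D_def x_def)
    then show ?thesis
      using True x by (simp add: uncountable_if_unbounded_aleph1 le_infI2)
  next
    case False
    obtain \<xi> where "\<xi> \<in> Field aleph1"
      using infinite_Field_aleph1 by fastforce
    then obtain s F where sF: "(s, F) \<in> G" "\<alpha> \<in> F"
      using G(2)[of "D (\<alpha>, \<xi>)"] \<alpha> False by (fastforce simp: D_def)
    \<comment> \<open>A point of \<open>x\<close> lies in some \<open>t\<close> and thus in a common
      extension \<open>r\<close> of both conditions; the promise for \<alpha> keeps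
      \<open>r - s\<close> away from \<open>e \<alpha>\<close>.\<close>
    have "e \<alpha> \<inter> x \<subseteq> s"
    proof
      fix y assume y: "y \<in> e \<alpha> \<inter> x"
      then obtain t H where "(t, H) \<in> G" "y \<in> t" by (auto simp: x_def)
      then obtain r K where "((s, F), (r, K)) \<in> ?le" "((t, H), (r, K)) \<in> ?le"
        using G(1) sF(1) unfolding forcing_filter_def by (metis surj_pair)
      then show "y \<in> s"
        using y sF(2) \<open>y \<in> t\<close> unfolding mem_depicting_order by blast
    qed
    moreover have "countable s"
      using sF(1) GP by (auto simp: mem_depicting_conditions)
    ultimately show ?thesis
      using False countable_subset by blast
  qed
  then show ?thesis
    using x depicts_aleph1_iff unfolding indepictable_def by metis
qed

section \<open>Upper bound: an indepictable pair from the branches of a tree\<close>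

text \<open>
  A subset \<open>f\<close> of \<open>\<omega>\<^sub>1\<close> is the branch of the nodes \<open>(\<alpha>, f \<inter> \<alpha>)\<close>; CH allows to code all nodes by
  elements of \<open>\<omega>\<^sub>1\<close>.
\<close>

lemma almost_disjoint_family_branches:
  assumes CH: "ctwo ^c aleph0 =o aleph1"
  obtains e :: "nat set set \<Rightarrow> nat set set" where "almost_disjoint_family aleph1 |Pow (Field aleph1)| e"
proof -
  let ?N = "Field aleph1 \<times> {s. s \<subseteq> Field aleph1 \<and> countable s}"
  have "|?N| \<le>o |Field aleph1|"
    using card_of_Times_ordLeq_infinite_Field[of "|Field aleph1|" "Field aleph1"] infinite_Field_aleph1
      card_of_countable_subsets_aleph1[OF CH]
    by (simp add: card_of_mono1 Field_card_of card_of_card_order_on)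
  then obtain j where j: "inj_on j ?N" "j ` ?N \<subseteq> Field aleph1"
    unfolding card_of_ordLeq[symmetric] by blast
  define node where "node f \<alpha> = (\<alpha>, f \<inter> underS aleph1 \<alpha>)" for f :: "nat set set" and \<alpha>
  define e where "e f = (\<lambda>\<alpha>. j (node f \<alpha>)) ` Field aleph1" for f
  have node: "node f \<alpha> \<in> ?N" if "f \<in> Pow (Field aleph1)" "\<alpha> \<in> Field aleph1" for f \<alpha>
    using that by (auto simp: node_def countable_underS_aleph1)
  have sub: "e f \<subseteq> Field aleph1" if "f \<in> Pow (Field aleph1)" for f
    using node[OF that] j(2) by (auto simp: e_def)
  have eq: "node f \<alpha> = node g \<beta>"
    if "j (node f \<alpha>) = j (node g \<beta>)" "f \<in> Pow (Field aleph1)" "g \<in> Pow (Field aleph1)"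
      "\<alpha> \<in> Field aleph1" "\<beta> \<in> Field aleph1" for f g \<alpha> \<beta>
    using inj_onD[OF j(1) that(1)] node that by blast
  \<comment> \<open>A node records its level, so distinct levels of a branch receive distinct
    codes.\<close>
  have "uncountable (e f)" if f: "f \<in> Pow (Field aleph1)" for f
  proof -
    have "inj_on (\<lambda>\<alpha>. j (node f \<alpha>)) (Field aleph1)"
      using eq[OF _ f f] by (auto intro!: inj_onI simp: node_def)
    then show ?thesis
      unfolding e_def using uncountable_Field_aleph1 countable_image_inj_on by blast
  qed
  moreover have "countable (e f \<inter> e g)"
    if f: "f \<in> Pow (Field aleph1)" and g: "g \<in> Pow (Field aleph1)" and "f \<noteq> g" for f g
  proof -
    \<comment> \<open>Two branches separate once a level exceeds a point \<xi> at which
      \<open>f\<close> and \<open>g\<close> differ, so they share only nodes of level at most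
      \<xi>.\<close>
    obtain \<xi> where \<xi>: "\<xi> \<in> Field aleph1" "\<xi> \<in> f \<longleftrightarrow> \<xi> \<notin> g"
      using f g \<open>f \<noteq> g\<close> by blast
    have "e f \<inter> e g \<subseteq> (\<lambda>\<alpha>. j (node f \<alpha>)) ` insert \<xi> (underS aleph1 \<xi>)"
    proof
      fix y assume "y \<in> e f \<inter> e g"
      then obtain \<alpha> \<beta> where *: "\<alpha> \<in> Field aleph1" "\<beta> \<in> Field aleph1"
        "y = j (node f \<alpha>)" "y = j (node g \<beta>)" by (auto simp: e_def)
      then have "f \<inter> underS aleph1 \<alpha> = g \<inter> underS aleph1 \<alpha>"
        using eq[OF _ f g, of \<alpha> \<beta>] by (auto simp: node_def)
      then have "\<xi> \<notin> underS aleph1 \<alpha>"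
        using \<xi>(2) by blast
      then show "y \<in> (\<lambda>\<alpha>. j (node f \<alpha>)) ` insert \<xi> (underS aleph1 \<xi>)"
        using not_in_underS_aleph1[OF \<xi>(1) *(1)] *(3) by blast
    qed
    then show ?thesis
      by (rule countable_subset) (simp add: countable_underS_aleph1)
  qed
  ultimately have "almost_disjoint_family aleph1 |Pow (Field aleph1)| e"
    unfolding almost_disjoint_family_def Field_card_of countable_iff_ordLess_aleph1[symmetric]
    using sub uncountable_iff_ordIso_aleph1 by simp
  then show ?thesis by (rule that)
qed

text \<open>Each \<open>x\<close> depicts a single subset of the index set. If every subset were
  depicted, \<open>depicted\<close> would map \<open>Pow (Field \<mu>)\<close> onto its own power
  set, against Cantor's theorem.\<close>

lemma has_indepictable_pair_Pow:
  assumes "almost_disjoint_family \<mu> |Pow (Field \<mu>)| e"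
  shows "has_indepictable_pair \<mu> |Pow (Field \<mu>)|"
proof (rule ccontr)
  define depicted where "depicted x = {\<alpha> \<in> Pow (Field \<mu>). ( |e \<alpha> \<inter> x| =o \<mu>)}" for x
  assume neg: "\<not> has_indepictable_pair \<mu> |Pow (Field \<mu>)|"
  have "Pow (Pow (Field \<mu>)) \<subseteq> depicted ` Pow (Field \<mu>)"
  proof
    fix A assume "A \<in> Pow (Pow (Field \<mu>))"
    then have A: "A \<subseteq> Pow (Field \<mu>)" by blast
    have "\<not> indepictable \<mu> |Pow (Field \<mu>)| A e"
      using neg assms A unfolding has_indepictable_pair_def Field_card_of by blast
    then obtain x where "x \<subseteq> Field \<mu>" "depicts \<mu> |Pow (Field \<mu>)| x A e"
      unfolding indepictable_def by blast
    moreover from this(2) have "A = depicted x"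
      using A by (auto simp: depicted_def depicts_def Field_card_of)
    ultimately show "A \<in> depicted ` Pow (Field \<mu>)"
      by blast
  qed
  moreover have "depicted ` Pow (Field \<mu>) \<subseteq> Pow (Pow (Field \<mu>))"
    by (auto simp: depicted_def)
  ultimately have "depicted ` Pow (Field \<mu>) = Pow (Pow (Field \<mu>))"
    by (rule subset_antisym[rotated])
  then show False
    using Cantors_theorem[of "Pow (Field \<mu>)"] by (elim notE exI)
qed

section \<open>The value of \<open>ap aleph1\<close>\<close>

theorem theorem3p1:
  fixes \<kappa> :: "'k rel"
  assumes "baumgartner_axiom TYPE(nat set set)"
    and "ctwo ^c aleph0 =o aleph1"
    and "Card_order \<kappa>"
    and "ctwo ^c aleph1 =o \<kappa>"
  shows "ap aleph1 =o \<kappa>"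
proof -
  let ?\<nu> = "|Pow (Field aleph1)|"
  let ?ap = "\<lambda>\<nu>. Card_order \<nu> \<and> has_indepictable_pair aleph1 \<nu> \<and>
     (\<forall>\<nu>' :: nat set set rel. Card_order \<nu>' \<and> has_indepictable_pair aleph1 \<nu>' \<longrightarrow> \<nu> \<le>o \<nu>')"
  have pow: "ctwo ^c aleph1 =o ?\<nu>"
    by (rule ctwo_cexp_ordIso_Pow[OF Card_order_aleph1])
  have pair: "has_indepictable_pair aleph1 ?\<nu>"
    using almost_disjoint_family_branches[OF assms(2)] has_indepictable_pair_Pow by metis
  have "?\<nu> \<le>o \<nu>'" if "Card_order \<nu>'" "has_indepictable_pair aleph1 \<nu>'" for \<nu>' :: "nat set set rel"
  proof (rule ccontr)
    assume "\<not> ?\<nu> \<le>o \<nu>'"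
    then have "\<nu>' <o ?\<nu>"
      using that(1) by (simp add: card_of_Well_order card_order_on_well_order_on not_ordLeq_iff_ordLess)
    then have "\<nu>' <o ctwo ^c aleph1"
      using ordLess_ordIso_trans ordIso_symmetric[OF pow] by blast
    moreover have "?\<nu> \<le>o |UNIV :: nat set set set|"
      by (rule card_of_mono1) simp
    ultimately show False
      using depictable_if_baumgartner_axiom[OF assms(1) _ assms(2) that(1)] that(2)
      unfolding has_indepictable_pair_def by blast
  qed
  then have \<nu>: "?ap ?\<nu>"
    using pair card_of_Card_order by blast
  \<comment> \<open>The power set cardinal witnesses that the choice in \<open>ap\<close> is not
    vacuous. The chosen cardinal and this witness are both minimal, hence equal up to
    \<open>=o\<close>.\<close>
  then have "?ap (ap aleph1)"
    unfolding ap_def by (rule someI)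
  with \<nu> have "ap aleph1 =o ?\<nu>"
    unfolding ordIso_iff_ordLeq by blast
  then show ?thesis
    using ordIso_transitive[OF ordIso_symmetric[OF pow] assms(4)] ordIso_transitive by blast
qed

end
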